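(* The triangular array $A[n,k]$, where $n\in\mathbb N_0$ and $k\in\{0,\ldots,n\}$ (with $A[n,k]$ defined explicitly in the context), is uniquely determined by the following properties (that is, it satisfies them, and it is the only array indexed by $n\in\mathbb N_0$, $k\in\{0,\ldots,n\}$ that does): (i) $A[n,0]=1$ for all $n\in\mathbb N_0$; (ii) $A[n,n]=2^{-n}(n!)^2/\Gamma(\frac n2+1)^2$ and $A[n,n-1]=\frac{\pi}{2}A[n,n]$ for all $n\in\mathbb N$; (iii) $A[n,k]=A[n-2,k]+(n-1)^2A[n-2,k-2]$ for all $n\ge 4$ and $k\in\{2,\ldots,n-2\}$; (iv) $A[n,1]=\frac1\pi\left((-1)^{n-1}+1+\sum_{k=2}^n(-1)^k\frac{\pi^k}{k!}A[n,k]\right)$ for all $n\ge3$.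
   Context: Notation: $\mathbb N=\{1,2,\ldots\}$, $\mathbb N_0=\{0,1,2,\ldots\}$. Definition of $A[n,k]$ for $n\in\mathbb N_0$, $k\in\mathbb Z$: put $Q_0(x)=Q_1(x)=1$ and $Q_n(x)=\prod_{j\in\{1,\ldots,n-1\},\ j\not\equiv n\ (\mathrm{mod}\ 2)}(1+j^2x^2)$ for $n\ge2$. Then $A[n,k]=[x^k]Q_n(x)$ if $k$ is even; $A[n,k]=[x^k]\left(\tanh(\frac{\pi}{2x})Q_n(x)\right)$ if $k$ is odd and $n$ is even; $A[n,k]=[x^k]\left(\coth(\frac{\pi}{2x})Q_n(x)\right)$ if $k$ is odd and $n$ is odd. Here $[x^k]H(x)$ is the coefficient of $x^k$ in $H(x)$, a formal series in positive and negative powers of $x$; $\tanh(\pi/(2x))$ and $\coth(\pi/(2x))$ are expanded in powers of $1/x$ via the Laurent expansions of $\tanh y$ and $\coth y$ at $y=0$ with $y=\pi/(2x)$. *)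

theory Defs
  imports "HOL-Complex_Analysis.Laurent_Convergence"
begin

text \<open>
  A formal series in positive and negative powers of \<open>x\<close> with only finitely many positive
  exponents is represented as a formal Laurent series in \<open>1/x\<close>. Thus \<open>x\<close> itself is
  \<^const>\<open>fls_X_inv\<close>, \<open>1/x\<close> is \<^const>\<open>fls_X\<close>, and the coefficient of \<open>x\<^sup>k\<close> has
  index \<open>-k\<close>.
\<close>

definition coeff_x :: "real fls \<Rightarrow> int \<Rightarrow> real" where
  "coeff_x H k = fls_nth H (- k)"

text \<open>For \<open>n \<le> 1\<close> the product is empty.\<close>

definition Q :: "nat \<Rightarrow> 'a::comm_ring_1 \<Rightarrow> 'a" where
  "Q n x = (\<Prod>j\<in>{j\<in>{1..<n}. j mod 2 \<noteq> n mod 2}. 1 + of_nat j ^ 2 * x ^ 2)"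

definition fls_sinh :: "'a::field_char_0 fls" where
  "fls_sinh = fps_to_fls (fps_const (1/2) * (fps_exp 1 - fps_exp (-1)))"

definition fls_cosh :: "'a::field_char_0 fls" where
  "fls_cosh = fps_to_fls (fps_const (1/2) * (fps_exp 1 + fps_exp (-1)))"

definition fls_tanh :: "'a::field_char_0 fls" where
  "fls_tanh = fls_sinh / fls_cosh"

definition fls_coth :: "'a::field_char_0 fls" where
  "fls_coth = fls_cosh / fls_sinh"

text \<open>Over the complex numbers these are the Laurent expansions at \<open>0\<close> of the analytic functions.\<close>

lemma has_laurent_expansion_sinh: "sinh has_laurent_expansion (fls_sinh :: complex fls)"
proof -
  have "(\<lambda>z::complex. (1/2) * (exp z - exp (-z))) has_fps_expansion
          fps_const (1/2) * (fps_exp 1 - fps_exp (-1))"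
    by (intro fps_expansion_intros)
  also have "(\<lambda>z::complex. (1/2) * (exp z - exp (-z))) = sinh"
    by (auto simp: sinh_def scaleR_conv_of_real)
  finally show ?thesis
    unfolding fls_sinh_def by (rule has_laurent_expansion_fps)
qed

lemma has_laurent_expansion_cosh: "cosh has_laurent_expansion (fls_cosh :: complex fls)"
proof -
  have "(\<lambda>z::complex. (1/2) * (exp z + exp (-z))) has_fps_expansion
          fps_const (1/2) * (fps_exp 1 + fps_exp (-1))"
    by (intro fps_expansion_intros)
  also have "(\<lambda>z::complex. (1/2) * (exp z + exp (-z))) = cosh"
    by (auto simp: cosh_def scaleR_conv_of_real)
  finally show ?thesis
    unfolding fls_cosh_def by (rule has_laurent_expansion_fps)
qed

lemma has_laurent_expansion_tanh: "tanh has_laurent_expansion (fls_tanh :: complex fls)"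
  unfolding fls_tanh_def tanh_def [abs_def]
  by (intro has_laurent_expansion_divide has_laurent_expansion_sinh has_laurent_expansion_cosh)

lemma has_laurent_expansion_coth:
  "(\<lambda>z. cosh z / sinh z) has_laurent_expansion (fls_coth :: complex fls)"
  unfolding fls_coth_def
  by (intro has_laurent_expansion_divide has_laurent_expansion_sinh has_laurent_expansion_cosh)

text \<open>\<open>tanh (\<pi>/(2x))\<close> and \<open>coth (\<pi>/(2x))\<close>, i.e. \<open>y = (\<pi>/2) (1/x)\<close> is substituted.\<close>

definition tanh_ser :: "real fls" where
  "tanh_ser = fls_compose_fps fls_tanh (fps_const (pi / 2) * fps_X)"

definition coth_ser :: "real fls" where
  "coth_ser = fls_compose_fps fls_coth (fps_const (pi / 2) * fps_X)"

definition A :: "nat \<Rightarrow> int \<Rightarrow> real" where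
  "A n k =
     (if even k then coeff_x (Q n fls_X_inv) k
      else if even n then coeff_x (tanh_ser * Q n fls_X_inv) k
      else coeff_x (coth_ser * Q n fls_X_inv) k)"

text \<open>
  Only entries \<open>B n k\<close> with \<open>k \<le> n\<close> are referred to, so this is a property of the
  triangular array; no natural-number subtraction below truncates.
\<close>

definition array_properties :: "(nat \<Rightarrow> nat \<Rightarrow> real) \<Rightarrow> bool" where
  "array_properties B \<longleftrightarrow>
     (\<forall>n. B n 0 = 1) \<and>
     (\<forall>n\<ge>1. B n n = 2 powi (- int n) * (fact n)\<^sup>2 / (Gamma (real n / 2 + 1))\<^sup>2 \<and>
             B n (n - 1) = pi / 2 * B n n) \<and>
     (\<forall>n\<ge>4. \<forall>k\<in>{2..n - 2}. B n k = B (n - 2) k + (real n - 1)\<^sup>2 * B (n - 2) (k - 2)) \<and>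
     (\<forall>n\<ge>3. B n 1 = 1 / pi * ((-1) ^ (n - 1) + 1 +
                (\<Sum>k=2..n. (-1) ^ k * (pi ^ k / fact k) * B n k)))"

end

theory Submission
  imports Defs
begin

text \<open>
  Write \<open>t = 1/x\<close> and let \<open>T\<close> be \<open>tanh (\<pi>t/2)\<close> or \<open>coth (\<pi>t/2)\<close> according to the parity of
  \<open>n\<close>. As \<open>Q\<^sub>n\<close> is even and \<open>T\<close> is odd, \<open>A[n,k]\<close> is the coefficient of \<open>x\<^sup>k\<close> in
  \<open>(1 + T) Q\<^sub>n\<close>, and \<open>(-1)\<^sup>k A[n,k]\<close> is that in \<open>(1 - T) Q\<^sub>n\<close>. Properties (i)--(iii) come from
  \<open>Q\<^sub>n = (1 + (n-1)\<^sup>2 x\<^sup>2) Q\<^sub>n\<^sub>-\<^sub>2\<close>. Property (iv) is the comparison of constant coefficients in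
  \<open>e\<^sup>-\<^sup>\<pi>\<^sup>t (1 + T) Q\<^sub>n = (-1)\<^sup>n (1 - T) Q\<^sub>n\<close>.
\<close>

section \<open>The hyperbolic series\<close>

definition hyp_ser :: "nat \<Rightarrow> real fls" where
  "hyp_ser n = (if even n then tanh_ser else coth_ser)"

lemma hyp_ser_simps [simp]:
  "hyp_ser 0 = tanh_ser" "hyp_ser (Suc 0) = coth_ser" "hyp_ser (Suc (Suc n)) = hyp_ser n"
  by (simp_all add: hyp_ser_def)

text \<open>Substituting \<open>- fps_X\<close> multiplies the coefficient of index \<open>n\<close>
  by \<open>(-1) powi n\<close>, so for an odd series and even \<open>n\<close> that coefficient
  equals its own negative.\<close>

lemma fls_nth_odd_eq_0:
  fixes F :: "'a::field_char_0 fls"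
  assumes "fls_compose_fps F (- fps_X) = - F" "even n"
  shows "fls_nth F n = 0"
proof -
  have "fls_nth (fls_compose_fps F (fps_const (-1) * fps_X)) n = fls_nth F n * (-1) powi n"
    by (rule fls_nth_fls_compose_fps_linear) simp
  moreover have "fps_const (-1) * fps_X = (- fps_X :: 'a fps)"
    by (simp flip: fps_const_neg)
  ultimately have "- fls_nth F n = fls_nth F n"
    using assms by simp
  then show ?thesis
    by (simp add: neg_eq_iff_add_eq_0 flip: mult_2)
qed

lemma fls_compose_sinh_neg: "fls_compose_fps fls_sinh (- fps_X) = - (fls_sinh :: 'a::field_char_0 fls)"
proof -
  have "fls_compose_fps fls_sinh (- fps_X :: 'a fps) =
      fps_to_fls (fps_const (1/2) * (fps_exp (-1) - fps_exp 1))"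
    unfolding fls_sinh_def
    by (subst fls_compose_fps_to_fls) (simp_all add: fps_compose_mult_distrib fps_compose_sub_distrib)
  then show ?thesis
    by (simp add: fls_sinh_def algebra_simps flip: fps_to_fls_uminus)
qed

lemma fls_compose_cosh_neg: "fls_compose_fps fls_cosh (- fps_X) = (fls_cosh :: 'a::field_char_0 fls)"
  unfolding fls_cosh_def
  by (subst fls_compose_fps_to_fls)
     (simp_all add: fps_compose_mult_distrib fps_compose_add_distrib add.commute)

lemma hyp_ser_nth_even:
  assumes "even k"
  shows "fls_nth (hyp_ser n) k = 0"
proof -
  have "fls_compose_fps fls_tanh (- fps_X) = - (fls_tanh :: real fls)"
       "fls_compose_fps fls_coth (- fps_X) = - (fls_coth :: real fls)"
    by (simp_all add: fls_tanh_def fls_coth_def fls_compose_fps_divide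
        fls_compose_sinh_neg fls_compose_cosh_neg)
  then have "fls_nth (fls_tanh :: real fls) k = 0" "fls_nth (fls_coth :: real fls) k = 0"
    using assms by (blast intro: fls_nth_odd_eq_0)+
  then show ?thesis
    by (simp add: hyp_ser_def tanh_ser_def coth_ser_def fls_nth_fls_compose_fps_linear)
qed

lemma fls_sinh_subdegree [simp]: "fls_subdegree (fls_sinh :: real fls) = 1"
  by (rule fls_subdegree_eqI) (auto simp: fls_sinh_def)

lemma fls_cosh_subdegree [simp]: "fls_subdegree (fls_cosh :: real fls) = 0"
  by (rule fls_subdegree_eqI) (auto simp: fls_cosh_def)

lemma fls_sinh_nth_1: "fls_nth (fls_sinh :: real fls) 1 = 1"
  and fls_cosh_nth_0: "fls_nth (fls_cosh :: real fls) 0 = 1"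
  by (simp_all add: fls_sinh_def fls_cosh_def)

lemma fls_sinh_nonzero [simp]: "(fls_sinh :: real fls) \<noteq> 0"
  using fls_sinh_subdegree by force

lemma fls_cosh_nonzero [simp]: "(fls_cosh :: real fls) \<noteq> 0"
  \<comment> \<open>The subdegree 0 does not help here, since the zero series has it too.\<close>
  by (rule fls_nonzeroI [of _ 0]) (simp add: fls_cosh_def)

lemma tanh_ser_nth:
  "k < 1 \<Longrightarrow> fls_nth tanh_ser k = 0" "fls_nth tanh_ser 1 = pi / 2"
proof -
  have "fls_nth (fls_tanh :: real fls) k = 0" if "k < 1" for k
    using that unfolding fls_tanh_def by (intro fls_divide_nth_below) auto
  then show "k < 1 \<Longrightarrow> fls_nth tanh_ser k = 0"
    by (simp add: tanh_ser_def fls_nth_fls_compose_fps_linear)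
  have "fls_nth (fls_tanh :: real fls) 1 = 1"
    using fls_divide_nth_base [of "fls_sinh :: real fls" fls_cosh]
    by (simp add: fls_tanh_def fls_sinh_nth_1 fls_cosh_nth_0)
  then show "fls_nth tanh_ser 1 = pi / 2"
    by (simp add: tanh_ser_def fls_nth_fls_compose_fps_linear)
qed

lemma coth_ser_nth:
  "k < -1 \<Longrightarrow> fls_nth coth_ser k = 0" "fls_nth coth_ser (-1) = 2 / pi"
proof -
  have "fls_nth (fls_coth :: real fls) k = 0" if "k < -1" for k
    using that unfolding fls_coth_def by (intro fls_divide_nth_below) auto
  then show "k < -1 \<Longrightarrow> fls_nth coth_ser k = 0"
    by (simp add: coth_ser_def fls_nth_fls_compose_fps_linear)
  have "fls_nth (fls_coth :: real fls) (-1) = 1"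
    using fls_divide_nth_base [of "fls_cosh :: real fls" fls_sinh]
    by (simp add: fls_coth_def fls_sinh_nth_1 fls_cosh_nth_0)
  then show "fls_nth coth_ser (-1) = 2 / pi"
    by (simp add: coth_ser_def fls_nth_fls_compose_fps_linear)
qed

text \<open>With y = pi t/2 this is exp(-2y) (cosh y + sinh y) = cosh y - sinh y, divided by cosh y
  for even \<open>n\<close> and by sinh y for odd \<open>n\<close>.\<close>

lemma exp_mult_hyp_ser:
  "fps_to_fls (fps_exp (-pi)) * (1 + hyp_ser n) = (-1) ^ n * (1 - hyp_ser n)"
proof -
  define E where "E = fps_to_fls (fps_exp (pi / 2))"
  define E' where "E' = fps_to_fls (fps_exp (- pi / 2))"
  define S where "S = fls_compose_fps fls_sinh (fps_const (pi / 2) * fps_X)"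
  define C where "C = fls_compose_fps fls_cosh (fps_const (pi / 2) * fps_X)"
  have nz: "S \<noteq> 0" "C \<noteq> 0"
    by (simp_all add: S_def C_def fls_compose_fps_eq_0_iff)
  have half: "2 * fls_const (1 / 2) = (1 :: real fls)"
    by (metis fls_const_mult_const fls_const_1 fls_const_numeral mult.commute
        nonzero_mult_div_cancel_left times_divide_eq_right mult_1_right zero_neq_numeral)
  have "S = fls_const (1 / 2) * (E - E')"
    unfolding S_def E_def E'_def fls_sinh_def
    by (subst fls_compose_fps_to_fls)
       (simp_all add: fps_compose_mult_distrib fps_compose_sub_distrib fls_times_fps_to_fls)
  then have S: "2 * S = E - E'"
    using half by (simp flip: mult.assoc)
  have "C = fls_const (1 / 2) * (E + E')"
    unfolding C_def E_def E'_def fls_cosh_def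
    by (subst fls_compose_fps_to_fls)
       (simp_all add: fps_compose_mult_distrib fps_compose_add_distrib fls_times_fps_to_fls)
  then have C: "2 * C = E + E'"
    using half by (simp flip: mult.assoc)
  have EE': "E * E' = 1"
    unfolding E_def E'_def fls_times_fps_to_fls [symmetric] fps_exp_add_mult [symmetric] by simp
  have F: "fps_to_fls (fps_exp (-pi)) = E' * E'"
    unfolding E'_def fls_times_fps_to_fls [symmetric] fps_exp_add_mult [symmetric] by simp
  have sum: "S + C = E" and diff: "C - S = E'"
    using S C by algebra+
  have key: "E' * E' * (S + C) = C - S"
    using EE' unfolding sum diff by algebra
  have T: "tanh_ser = S / C" "coth_ser = C / S"
    by (simp_all add: tanh_ser_def coth_ser_def S_def C_def fls_tanh_def fls_coth_def
        fls_compose_fps_divide)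
  have "E' * E' * (1 + S / C) = E' * E' * (S + C) / C"
       "E' * E' * (1 + C / S) = E' * E' * (S + C) / S"
    using nz by (simp_all add: field_simps)
  \<comment> \<open>Dividing \<open>C - S\<close> by \<open>S\<close> gives
    \<open>C / S - 1\<close>; this is the source of the sign for odd \<open>n\<close>.\<close>
  then have "E' * E' * (1 + S / C) = 1 - S / C" "E' * E' * (1 + C / S) = - (1 - C / S)"
    using nz by (simp_all only: key) (simp_all add: diff_divide_distrib)
  then show ?thesis
    by (simp add: hyp_ser_def T F)
qed

section \<open>The recursion and its consequences\<close>

lemma Q_0 [simp]: "Q 0 x = 1" and Q_1 [simp]: "Q (Suc 0) x = 1"
  by (simp_all add: Q_def)

lemma Q_Suc_Suc: "Q (Suc (Suc n)) x = Q n x * (1 + of_nat (Suc n) ^ 2 * x ^ 2)"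
proof -
  \<comment> \<open>Of \<open>n\<close> and \<open>n + 1\<close>, only the latter differs in parity
    from \<open>n + 2\<close>.\<close>
  have "{j \<in> {1..<Suc (Suc n)}. j mod 2 \<noteq> Suc (Suc n) mod 2} =
      insert (Suc n) {j \<in> {1..<n}. j mod 2 \<noteq> n mod 2}"
    by (auto simp: less_Suc_eq) presburger+
  then show ?thesis
    by (simp add: Q_def mult.commute)
qed

text \<open>Multiplication by x^2 shifts exponents by two. \<open>H\<close> stays arbitrary so that
  one recursion serves \<open>1\<close>, both hyperbolic series, \<open>1 + hyp_ser n\<close> and
  \<open>1 - hyp_ser n\<close>.\<close>

lemma coeff_x_mult_Q_Suc_Suc:
  "coeff_x (H * Q (Suc (Suc n)) fls_X_inv) k =
     coeff_x (H * Q n fls_X_inv) k + (real n + 1)\<^sup>2 * coeff_x (H * Q n fls_X_inv) (k - 2)"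
proof -
  have "H * Q (Suc (Suc n)) fls_X_inv = H * Q n fls_X_inv +
      fls_const ((real n + 1)\<^sup>2) * (fls_X_inv ^ 2 * (H * Q n fls_X_inv))"
    by (simp add: Q_Suc_Suc fls_of_nat algebra_simps power2_eq_square
        flip: fls_const_mult_const fls_plus_const)
  then show ?thesis
    by (simp add: coeff_x_def fls_X_inv_power_times_conv_shift)
qed

text \<open>The parities of \<open>n\<close> and \<open>k\<close> do not change, so all three
  entries fall under the same case of the definition. Unlike (iii), this covers every integer
  \<open>k\<close>.\<close>

lemma A_rec: "A (Suc (Suc n)) k = A n k + (real n + 1)\<^sup>2 * A n (k - 2)"
  using coeff_x_mult_Q_Suc_Suc [of 1 n k]
  by (simp add: A_def coeff_x_mult_Q_Suc_Suc)

lemma A_0: "A 0 k = (if even k then if k = 0 then 1 else 0 else fls_nth tanh_ser (- k))"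
  by (simp add: A_def coeff_x_def)

lemma A_1: "A (Suc 0) k = (if even k then if k = 0 then 1 else 0 else fls_nth coth_ser (- k))"
  by (simp add: A_def coeff_x_def)

text \<open>It is enough to compare at \<open>n\<close> = 0 and 1, where \<open>Q\<close> is 1: both
  sides obey the same recursion, and \<open>(-1) powi k\<close> is unchanged when \<open>k\<close>
  drops by two.\<close>

lemma coeff_x_hyp_ser_mult_Q:
  "coeff_x ((1 + hyp_ser n) * Q n fls_X_inv) k = A n k"
  "coeff_x ((1 - hyp_ser n) * Q n fls_X_inv) k = (-1) powi k * A n k"
proof -
  have "coeff_x ((1 + hyp_ser n) * Q n fls_X_inv) k = A n k \<and>
        coeff_x ((1 - hyp_ser n) * Q n fls_X_inv) k = (-1) powi k * A n k"
  proof (induction n arbitrary: k rule: nat_induct2)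
    case 0
    show ?case
      using hyp_ser_nth_even [of "-k" 0] by (simp add: coeff_x_def A_0)
  next
    case 1
    show ?case
      using hyp_ser_nth_even [of "-k" 1] by (simp add: coeff_x_def A_1)
  next
    case (step n)
    have "coeff_x ((1 + hyp_ser n) * Q n fls_X_inv) k = A n k"
         "coeff_x ((1 - hyp_ser n) * Q n fls_X_inv) k = (-1) powi k * A n k" for k
      using step by blast+
    then show ?case
      by (simp only: add_2_eq_Suc' hyp_ser_simps coeff_x_mult_Q_Suc_Suc A_rec)
         (simp add: power_int_diff distrib_left)
  qed
  then show "coeff_x ((1 + hyp_ser n) * Q n fls_X_inv) k = A n k"
    "coeff_x ((1 - hyp_ser n) * Q n fls_X_inv) k = (-1) powi k * A n k" by auto
qed

section \<open>Support and boundary entries of the array\<close>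

lemma A_eq_0: "k > int n \<Longrightarrow> A n k = 0"
proof (induction n arbitrary: k rule: nat_induct2)
  case 0
  then show ?case by (simp add: A_0 tanh_ser_nth)
next
  case 1
  then show ?case by (simp add: A_1 coth_ser_nth)
next
  case (step n)
  then show ?case by (simp add: A_rec)
qed

text \<open>The recursion lowers \<open>k\<close> by two, so the induction has to carry the negative
  even \<open>k\<close> along; \<open>k = 0\<close> gives (i).\<close>

lemma A_nonpos_even: "even k \<Longrightarrow> k \<le> 0 \<Longrightarrow> A n k = (if k = 0 then 1 else 0)"
proof (induction n arbitrary: k rule: nat_induct2)
  case (step n)
  then show ?case by (simp add: A_rec)
qed (simp_all add: A_0 A_1)

lemma A_diag: "A n (int n) = 2 powi (- int n) * (fact n)\<^sup>2 / (Gamma (real n / 2 + 1))\<^sup>2"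
proof (induction n rule: nat_induct2)
  case 0
  then show ?case by (simp add: A_0)
next
  case 1
  \<comment> \<open>The square pi/4 makes the right-hand side 2/pi, the leading coefficient of
    \<open>coth_ser\<close>.\<close>
  have "Gamma (1 / 2 + 1 :: real) = sqrt pi / 2"
    by (subst Gamma_plus1) (auto simp: Gamma_one_half_real elim!: nonpos_Ints_cases)
  then have "(Gamma (real 1 / 2 + 1))\<^sup>2 = pi / 4"
    by (simp only: of_nat_1 power_divide) simp
  then show ?case
    by (simp only:) (simp add: A_1 coth_ser_nth power_int_minus)
next
  case (step n)
  have "real n / 2 + 1 \<notin> \<int>\<^sub>\<le>\<^sub>0"
    using nonpos_Ints_nonpos [of "real n / 2 + 1"] by auto
  then have "Gamma (real (n + 2) / 2 + 1) = (real n / 2 + 1) * Gamma (real n / 2 + 1)"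
    using Gamma_plus1 [of "real n / 2 + 1"] by (simp add: add_divide_distrib add_ac)
  moreover have "Gamma (real n / 2 + 1) > 0"
    by (intro Gamma_real_pos) simp
  moreover have "A (n + 2) (int (n + 2)) = (real n + 1)\<^sup>2 * A n (int n)"
    by (simp add: A_rec A_eq_0)
  \<comment> \<open>The factor \<open>n + 2\<close> is written as 2 (n/2 + 1) so that it cancels
    against the factor gained by Gamma.\<close>
  moreover have "fact (n + 2) = 2 * (real n / 2 + 1) * (real n + 1) * fact n"
    by (simp add: algebra_simps)
  moreover have "(2 :: real) powi (- int (n + 2)) = 1 / (4 * 2 ^ n)" "(2 :: real) powi (- int n) = 1 / 2 ^ n"
    by (simp_all add: power_int_minus power_int_diff divide_simps)
  ultimately show ?case
    using step by (simp only: power_mult_distrib) (simp add: divide_simps)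
qed

text \<open>Entries beyond the diagonal vanish, so the recursion multiplies both sides by the same
  \<open>(n + 1)^2\<close>. For \<open>n = 0\<close> the left entry lies outside the triangle, at
  \<open>k = -1\<close>.\<close>

lemma A_subdiag: "A n (int n - 1) = pi / 2 * A n (int n)"
proof (induction n rule: nat_induct2)
  case 0
  then show ?case by (simp add: A_0 tanh_ser_nth)
next
  case 1
  then show ?case by (simp add: A_1 coth_ser_nth)
next
  case (step n)
  then show ?case by (simp add: A_rec A_eq_0 algebra_simps)
qed

section \<open>Constant coefficients and property (iv)\<close>

lemma fls_nth_fps_to_fls_mult_0:
  fixes F :: "'a::comm_ring_1 fps"
  assumes "\<And>k. k > int n \<Longrightarrow> fls_nth G (- k) = 0"
  shows "fls_nth (fps_to_fls F * G) 0 = (\<Sum>k\<le>n. fps_nth F k * fls_nth G (- int k))"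
proof -
  define d where "d = fls_subdegree (fps_to_fls F)"
  \<comment> \<open>The maximum covers both the convolution range and the target range, so their
    order need not be settled.\<close>
  define m where "m = max (int n) (- fls_subdegree G)"
  have "fls_nth (fps_to_fls F * G) 0 =
      (\<Sum>i=d..0 - fls_subdegree G. fls_nth (fps_to_fls F) i * fls_nth G (0 - i))"
    unfolding d_def by (rule fls_times_nth(2))
  also have "\<dots> = (\<Sum>i=0..m. fls_nth (fps_to_fls F) i * fls_nth G (0 - i))"
  proof (rule sum.mono_neutral_left)
    show "{d..0 - fls_subdegree G} \<subseteq> {0..m}"
      unfolding d_def m_def using fls_subdegree_fls_to_fps_gt0 [of F] by auto
    show "\<forall>i\<in>{0..m} - {d..0 - fls_subdegree G}. fls_nth (fps_to_fls F) i * fls_nth G (0 - i) = 0"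
    proof
      fix i assume "i \<in> {0..m} - {d..0 - fls_subdegree G}"
      then have "i < d \<or> 0 - i < fls_subdegree G"
        by auto
      then show "fls_nth (fps_to_fls F) i * fls_nth G (0 - i) = 0"
        unfolding d_def by (metis fls_eq0_below_subdegree mult_zero_left mult_zero_right)
    qed
  qed simp
  also have "\<dots> = (\<Sum>i=0..int n. fls_nth (fps_to_fls F) i * fls_nth G (0 - i))"
    by (rule sum.mono_neutral_right) (auto simp: m_def assms)
  also have "\<dots> = (\<Sum>k\<le>n. fps_nth F k * fls_nth G (- int k))"
    by (rule sum.reindex_bij_witness [of _ int nat]) auto
  finally show ?thesis .
qed

text \<open>This is (iv) before it is solved for \<open>A n 1\<close>: the left side is the constant
  coefficient of the exponential times the row series.\<close>

lemma sum_A: "(\<Sum>k\<le>n. (-pi) ^ k / fact k * A n (int k)) = (-1) ^ n"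
proof -
  let ?G = "(1 + hyp_ser n) * Q n fls_X_inv"
  have nth: "fls_nth ?G (- k) = A n k" for k
    using coeff_x_hyp_ser_mult_Q(1) [of n k] by (simp add: coeff_x_def)
  have "(\<Sum>k\<le>n. (-pi) ^ k / fact k * A n (int k)) =
      fls_nth (fps_to_fls (fps_exp (-pi)) * ?G) 0"
    by (subst fls_nth_fps_to_fls_mult_0 [of n]) (simp_all only: nth A_eq_0 fps_exp_nth of_nat_fact)
  also have "fps_to_fls (fps_exp (-pi)) * ?G = (-1) ^ n * ((1 - hyp_ser n) * Q n fls_X_inv)"
    by (simp only: exp_mult_hyp_ser flip: mult.assoc)
  \<comment> \<open>Up to the sign, the constant coefficient is \<open>A n 0\<close>, which is
    1.\<close>
  also have "fls_nth \<dots> 0 = (-1) ^ n"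
    using coeff_x_hyp_ser_mult_Q(2) [of n 0] A_nonpos_even [of 0 n]
    by (cases "even n") (simp_all add: coeff_x_def)
  finally show ?thesis .
qed

lemma A_one:
  assumes "n \<ge> 1"
  shows "A n 1 = 1 / pi * ((-1) ^ (n - 1) + 1 +
     (\<Sum>k=2..n. (-1) ^ k * (pi ^ k / fact k) * A n (int k)))"
proof -
  have "{..n} = insert 0 (insert 1 {2..n})"
    using assms by auto
  then have "(-1) ^ n = 1 + (- pi * A n 1 + (\<Sum>k=2..n. (-pi) ^ k / fact k * A n (int k)))"
    using sum_A [of n] by (simp add: A_nonpos_even)
  moreover have "(-pi) ^ k / fact k = (-1) ^ k * (pi ^ k / fact k)" for k
    by (simp add: power_minus [of pi])
  ultimately have "pi * A n 1 = - ((-1) ^ n) + 1 +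
      (\<Sum>k=2..n. (-1) ^ k * (pi ^ k / fact k) * A n (int k))"
    by simp
  moreover have "- ((-1) ^ n) = ((-1) ^ (n - 1) :: real)"
    using assms by (cases n) auto
  ultimately show ?thesis
    by (simp add: field_simps)
qed

section \<open>The four properties and uniqueness\<close>

lemma array_properties_A: "array_properties (\<lambda>n k. A n (int k))"
  unfolding array_properties_def
proof (intro conjI allI impI ballI)
  fix n k :: nat
  assume "n \<ge> 4" "k \<in> {2..n - 2}"
  then obtain m j where "n = Suc (Suc m)" "k = Suc (Suc j)"
    by (auto simp: le_iff_add numeral_eq_Suc)
  then show "A n (int k) = A (n - 2) (int k) + (real n - 1)\<^sup>2 * A (n - 2) (int (k - 2))"
    by (simp add: A_rec add.commute)
next
  fix n :: nat
  assume "n \<ge> 3"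
  then show "A n (int 1) = 1 / pi * ((-1) ^ (n - 1) + 1 +
     (\<Sum>k=2..n. (-1) ^ k * (pi ^ k / fact k) * A n (int k)))"
    using A_one [of n] by simp
next
  fix n :: nat
  assume "n \<ge> 1"
  then show "A n (int (n - 1)) = pi / 2 * A n (int n)"
    using A_subdiag [of n] by (simp only: of_nat_diff of_nat_1)
next
  fix n :: nat
  show "A n (int n) = 2 powi (- int n) * (fact n)\<^sup>2 / (Gamma (real n / 2 + 1))\<^sup>2"
    by (rule A_diag)
next
  fix n :: nat
  show "A n (int 0) = 1"
    by (simp add: A_nonpos_even)
qed

lemma array_propertiesD:
  assumes "array_properties B"
  shows "B n 0 = 1"
    and "n \<ge> 1 \<Longrightarrow> B n n = 2 powi (- int n) * (fact n)\<^sup>2 / (Gamma (real n / 2 + 1))\<^sup>2"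
    and "n \<ge> 1 \<Longrightarrow> B n (n - 1) = pi / 2 * B n n"
    and "n \<ge> 4 \<Longrightarrow> k \<in> {2..n - 2} \<Longrightarrow>
           B n k = B (n - 2) k + (real n - 1)\<^sup>2 * B (n - 2) (k - 2)"
    and "n \<ge> 3 \<Longrightarrow> B n 1 = 1 / pi * ((-1) ^ (n - 1) + 1 +
           (\<Sum>k=2..n. (-1) ^ k * (pi ^ k / fact k) * B n k))"
proof -
  note * = assms [unfolded array_properties_def]
  note 1 = * [THEN conjunct1, rule_format]
    and 2 = * [THEN conjunct2, THEN conjunct1, rule_format]
    and 3 = * [THEN conjunct2, THEN conjunct2, THEN conjunct1, rule_format]
    and 4 = * [THEN conjunct2, THEN conjunct2, THEN conjunct2, rule_format]
  show "B n 0 = 1"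
    by (rule 1)
  show "B n n = 2 powi (- int n) * (fact n)\<^sup>2 / (Gamma (real n / 2 + 1))\<^sup>2" if "n \<ge> 1"
    by (rule 2 [OF that, THEN conjunct1])
  show "B n (n - 1) = pi / 2 * B n n" if "n \<ge> 1"
    by (rule 2 [OF that, THEN conjunct2])
  show "B n k = B (n - 2) k + (real n - 1)\<^sup>2 * B (n - 2) (k - 2)" if "n \<ge> 4" "k \<in> {2..n - 2}"
    by (rule 3 [OF that])
  show "B n 1 = 1 / pi * ((-1) ^ (n - 1) + 1 +
      (\<Sum>k=2..n. (-1) ^ k * (pi ^ k / fact k) * B n k))" if "n \<ge> 3"
    by (rule 4 [OF that])
qed

text \<open>Within a row, (i) and (ii) fix the outer entries, (iii) the inner ones from row
  \<open>n - 2\<close>, and (iv) comes last, since it obtains the entry at 1 from all those with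
  \<open>k \<ge> 2\<close>.\<close>

lemma array_properties_unique:
  assumes "array_properties B" "array_properties C" "k \<le> n"
  shows "B n k = C n k"
  using \<open>k \<le> n\<close>
proof (induction n arbitrary: k rule: less_induct)
  case (less n)
  note B = array_propertiesD [OF assms(1), of n] and C = array_propertiesD [OF assms(2), of n]
  have zero: "B n 0 = C n 0"
    by (simp only: B(1) C(1))
  have top: "B n n = C n n" "B n (n - 1) = C n (n - 1)" if "n \<ge> 1"
    using that by (simp_all only: B(2,3) C(2,3))
  have outer: "B n j = C n j" if "j = 0 \<or> j = n \<or> j = n - 1" for j
    using that zero top by (cases "n = 0") auto
  have inner: "B n j = C n j" if j: "2 \<le> j" "j \<le> n - 2" for j
  proof -
    have "n \<ge> 4" "j \<in> {2..n - 2}"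
      using j by auto
    note B(4) [OF this] C(4) [OF this]
    moreover have "B (n - 2) j = C (n - 2) j" "B (n - 2) (j - 2) = C (n - 2) (j - 2)"
      using j by (auto intro!: less.IH)
    ultimately show ?thesis
      by (simp only:)
  qed
  have ge2: "B n j = C n j" if "2 \<le> j" "j \<le> n" for j
  proof -
    have "j \<le> n - 2 \<or> j = n \<or> j = n - 1"
      using that by linarith
    then show ?thesis
      using outer inner that(1) by blast
  qed
  \<comment> \<open>For \<open>n \<le> 2\<close> the entry at \<open>k = 1\<close> is already on or
    next to the diagonal, so (iv) is called only for \<open>n \<ge> 3\<close>.\<close>
  consider "k = 0 \<or> k = n \<or> k = n - 1" | "k \<ge> 2" | "k = 1" "n \<ge> 3"
    using less.prems by linarith
  then show ?case
  proof cases
    case 3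
    note B(5) [OF 3(2)] C(5) [OF 3(2)]
    moreover have "(\<Sum>k=2..n. (-1) ^ k * (pi ^ k / fact k) * B n k) =
        (\<Sum>k=2..n. (-1) ^ k * (pi ^ k / fact k) * C n k)"
      by (rule sum.cong) (auto simp: ge2)
    ultimately show ?thesis
      by (simp only: 3(1))
  qed (use outer ge2 less.prems in auto)
qed

theorem proposition1p2:
  shows "array_properties (\<lambda>n k. A n (int k)) \<and>
         (\<forall>B. array_properties B \<longrightarrow> (\<forall>n. \<forall>k\<le>n. B n k = A n (int k)))"
  using array_properties_A array_properties_unique by blast

end
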